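(* Assume the Hadamard conjecture, i.e. that for every positive integer $t$ there exists a Hadamard matrix of order $4t$. Then for every positive integer $n$, \[\mathcal R(n) \ge \begin{cases} \left(\frac{2}{\pi e}\right)^{1/2} & \text{if } n\equiv 1 \pmod 4,\\[4pt] \left(\frac{8}{\pi e^2 n}\right)^{1/2} & \text{if } n\equiv 2 \pmod 4,\\[4pt] (n+1)^{(n-1)/2}/n^{n/2} & \text{if } n\equiv 3\pmod 4,\end{cases}\] and in the last case $(n+1)^{(n-1)/2}/n^{n/2} \sim (e/n)^{1/2}$ as $n\to\infty$.
   Context: A Hadamard matrix of order $h$ is an $h\times h$ matrix with entries in $\{+1,-1\}$ whose determinant has absolute value $h^{h/2}$. For a positive integer $n$, $D(n)$ denotes the maximum of $\det M$ over all $n\times n$ matrices $M$ with entries in $\{+1,-1\}$, and $\mathcal R(n) := D(n)/n^{n/2}$. *)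

theory Defs
  imports Complex_Main
    "HOL-Library.Landau_Symbols"
    "HOL-Library.FuncSet"
    "Jordan_Normal_Form.Determinant"
begin

definition sign_matrices :: "nat \<Rightarrow> real mat set" where
  "sign_matrices n =
     {M \<in> carrier_mat n n. \<forall>i<n. \<forall>j<n. M $$ (i, j) \<in> {1, -1}}"

definition hadamard_matrix :: "nat \<Rightarrow> real mat \<Rightarrow> bool" where
  "hadamard_matrix h M \<longleftrightarrow>
     M \<in> sign_matrices h \<and> \<bar>det M\<bar> = real h powr (real h / 2)"

definition hadamard_conjecture :: bool where
  "hadamard_conjecture \<longleftrightarrow> (\<forall>t::nat. t > 0 \<longrightarrow> (\<exists>M. hadamard_matrix (4 * t) M))"

definition max_det :: "nat \<Rightarrow> real" where
  "max_det n = Max (det ` sign_matrices n)"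

definition det_ratio :: "nat \<Rightarrow> real" where
  "det_ratio n = max_det n / real n powr (real n / 2)"

text \<open>The set of determinants is finite and nonempty, so \<open>Max\<close> is a genuine maximum.\<close>

lemma finite_sign_matrices: "finite (sign_matrices n)"
proof -
  let ?F = "({..<n} \<times> {..<n}) \<rightarrow>\<^sub>E {1, -1 :: real}"
  have "sign_matrices n \<subseteq> mat n n ` ?F"
  proof
    fix M assume M: "M \<in> sign_matrices n"
    have "M = mat n n (restrict (\<lambda>p. M $$ p) ({..<n} \<times> {..<n}))"
      using M by (intro eq_matI) (auto simp: sign_matrices_def)
    moreover have "restrict (\<lambda>p. M $$ p) ({..<n} \<times> {..<n}) \<in> ?F"
      using M by (auto simp: sign_matrices_def)
    ultimately show "M \<in> mat n n ` ?F" by blast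
  qed
  moreover have "finite (mat n n ` ?F)"
    by (intro finite_imageI finite_PiE) auto
  ultimately show ?thesis by (rule finite_subset)
qed

lemma sign_matrices_nonempty: "sign_matrices n \<noteq> {}"
proof -
  have "mat n n (\<lambda>_. 1) \<in> sign_matrices n"
    by (auto simp: sign_matrices_def)
  then show ?thesis by blast
qed

lemma max_det_attained: "\<exists>M \<in> sign_matrices n. det M = max_det n"
proof -
  have "max_det n \<in> det ` sign_matrices n"
    unfolding max_det_def
    using finite_sign_matrices sign_matrices_nonempty by (intro Max_in) auto
  then show ?thesis by force
qed

lemma det_le_max_det: "M \<in> sign_matrices n \<Longrightarrow> det M \<le> max_det n"
  unfolding max_det_def using finite_sign_matrices by (intro Max_ge) auto

end

theory Submission
  imports "HOL-Analysis.Gamma_Function" "HOL-Real_Asymp.Real_Asymp" Defs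
begin

text \<open>Equality in Hadamard's inequality turns the determinant condition into \<open>M M\<^sup>T = h I\<close>.
  For \<open>n = h - 1\<close>, the adjugate of \<open>M\<close> is then \<open>(det M / h) M\<^sup>T\<close>, so every minor has absolute value
  \<open>h\<^bsup>h/2-1\<^esup>\<close>. For \<open>n = h + 1\<close>, border \<open>M\<close> by the column \<open>y = sgn (M x)\<close>, the row \<open>- x\<^sup>T\<close> and the
  corner 1, with determinant \<open>det M (1 + \<Sum>\<^sub>i |(M x)\<^sub>i| / h)\<close>; averaging over sign vectors \<open>x\<close> (Best's
  argument) makes the sum at least \<open>h\<^sup>2 (h choose h/2) / 2\<^sup>h\<close>, which Wallis' product estimates.
  For \<open>n \<equiv> 2\<close>, repeating a column and a row of a matrix of order \<open>n - 1\<close> with a sign change at the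
  corner doubles the determinant.\<close>

section \<open>Binomial sums and sums over sign vectors\<close>

text \<open>The absorption identity (j+1) C(n,j+1) = (n-j) C(n,j) makes the sum telescope.\<close>

lemma sum_binomial_partial:
  assumes "j \<le> n"
  shows "(\<Sum>k\<le>j. real (n choose k) * (real n - 2 * real k)) = (real n - real j) * real (n choose j)"
  using assms
proof (induction j)
  case (Suc j)
  have "real (Suc j * (n choose Suc j)) = real ((n - j) * (n choose j))"
    by (metis binomial_absorb_comp binomial_absorption)
  with Suc show ?case by (simp add: of_nat_diff algebra_simps)
qed simp

lemma sum_binomial_abs:
  "(\<Sum>k\<le>2*m. real ((2*m) choose k) * \<bar>real (2*m) - 2 * real k\<bar>) = 2 * real m * real ((2*m) choose m)"
proof -
  let ?f = "\<lambda>k. real ((2*m) choose k) * (real (2*m) - 2 * real k)"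
  \<comment> \<open>The absolute value is twice the positive part minus the term itself. The full
    sum vanishes, and the positive part is the partial sum up to \<open>m\<close>.\<close>
  have *: "real ((2*m) choose k) * \<bar>real (2*m) - 2 * real k\<bar> = 2 * (if k \<le> m then ?f k else 0) - ?f k" for k
    by (auto simp: abs_if algebra_simps)
  have "(\<Sum>k\<le>2*m. if k \<le> m then ?f k else 0) = (\<Sum>k\<le>m. ?f k)"
    by (rule sum.mono_neutral_cong_right) auto
  then show ?thesis
    using sum_binomial_partial[of m "2*m"] sum_binomial_partial[of "2*m" "2*m"]
    unfolding * by (simp add: sum_subtractf flip: sum_distrib_left)
qed

text \<open>One more step of a simple random walk, by Pascal's rule; this drives the induction in
  \<open>sum_signings\<close>.\<close>

lemma sum_binomial_Suc:
  fixes f :: "real \<Rightarrow> real"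
  shows "(\<Sum>k\<le>n. real (n choose k) * (f (real n - 2 * real k + 1) + f (real n - 2 * real k - 1)))
       = (\<Sum>k\<le>Suc n. real (Suc n choose k) * f (real (Suc n) - 2 * real k))"
proof -
  let ?g = "\<lambda>k. f (real (Suc n) - 2 * real k)"
  have A: "(\<Sum>k\<le>n. real (n choose Suc k) * ?g (Suc k)) = (\<Sum>k\<le>n. real (n choose k) * ?g k) - ?g 0"
    using sum.atMost_Suc_shift[of "\<lambda>k. real (n choose k) * ?g k" n]
    by (simp add: binomial_eq_0 del: of_nat_Suc)
  have "(\<Sum>k\<le>Suc n. real (Suc n choose k) * ?g k)
      = ?g 0 + (\<Sum>k\<le>n. real (n choose k) * ?g (Suc k)) + (\<Sum>k\<le>n. real (n choose Suc k) * ?g (Suc k))"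
    by (subst sum.atMost_Suc_shift) (simp add: sum.distrib algebra_simps)
  also have "\<dots> = (\<Sum>k\<le>n. real (n choose k) * (?g k + ?g (Suc k)))"
    unfolding A by (simp add: sum.distrib algebra_simps)
  finally show ?thesis by (simp add: algebra_simps)
qed

text \<open>Multiplying by fixed signs permutes the sign vectors, so the distribution of the sum
  does not depend on \<open>a\<close>; \<open>k\<close> counts the terms equal to -1.\<close>

lemma sum_signings:
  fixes a :: "'a \<Rightarrow> real" and f :: "real \<Rightarrow> real"
  assumes "finite A" "\<And>j. j \<in> A \<Longrightarrow> a j \<in> {1, -1}"
  shows "(\<Sum>X\<in>Pow A. f (\<Sum>j\<in>A. a j * (if j \<in> X then 1 else -1)))
       = (\<Sum>k\<le>card A. real (card A choose k) * f (real (card A) - 2 * real k))"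
  using assms
proof (induction A arbitrary: f rule: finite_induct)
  case (insert i A)
  let ?S = "\<lambda>B X. \<Sum>j\<in>B. a j * (if j \<in> X then 1 else -1)"
  have out: "?S (insert i A) X = ?S A X - a i" and into: "?S (insert i A) (insert i X) = ?S A X + a i"
    if "X \<in> Pow A" for X
  proof -
    have "i \<notin> X" using that insert by auto
    then show "?S (insert i A) X = ?S A X - a i" using insert by simp
    have "?S A (insert i X) = ?S A X" by (rule sum.cong) (use insert in auto)
    then show "?S (insert i A) (insert i X) = ?S A X + a i" using insert by simp
  qed
  have "(\<Sum>X\<in>Pow (insert i A). f (?S (insert i A) X))
      = (\<Sum>X\<in>Pow A. f (?S (insert i A) X)) + (\<Sum>X\<in>insert i ` Pow A. f (?S (insert i A) X))"
    unfolding Pow_insert using insert by (intro sum.union_disjoint) auto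
  also have "(\<Sum>X\<in>insert i ` Pow A. f (?S (insert i A) X))
           = (\<Sum>X\<in>Pow A. f (?S (insert i A) (insert i X)))"
  proof (subst sum.reindex)
    show "inj_on (insert i) (Pow A)"
      using insert.hyps by (intro inj_onI) (metis PowD insert_ident subsetD)
  qed simp
  also have "(\<Sum>X\<in>Pow A. f (?S (insert i A) X)) = (\<Sum>X\<in>Pow A. f (?S A X - a i))"
    by (intro sum.cong refl) (simp only: out)
  also have "(\<Sum>X\<in>Pow A. f (?S (insert i A) (insert i X))) = (\<Sum>X\<in>Pow A. f (?S A X + a i))"
    by (intro sum.cong refl) (simp only: into)
  \<comment> \<open>Whichever sign \<open>a i\<close> has, the two shifts are +1 and -1. The
    induction hypothesis is then applied to the symmetrised function, so \<open>f\<close> must be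
    arbitrary.\<close>
  also have "(\<Sum>X\<in>Pow A. f (?S A X - a i)) + (\<Sum>X\<in>Pow A. f (?S A X + a i))
      = (\<Sum>X\<in>Pow A. f (?S A X + 1) + f (?S A X - 1))"
    using insert.prems[of i] by (auto simp: sum.distrib)
  also have "\<dots> = (\<Sum>k\<le>card A. real (card A choose k)
      * (f (real (card A) - 2 * real k + 1) + f (real (card A) - 2 * real k - 1)))"
    using insert.IH[of "\<lambda>s. f (s + 1) + f (s - 1)"] insert.prems by auto
  also have "\<dots> = (\<Sum>k\<le>card (insert i A). real (card (insert i A) choose k)
      * f (real (card (insert i A)) - 2 * real k))"
    unfolding sum_binomial_Suc using insert by simp
  finally show ?case .
qed simp

section \<open>Central binomial coefficients by Wallis' product\<close>

text \<open>From \<open>m\<close> to \<open>m + 1\<close> the normalised coefficient gains the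
  factor (2m+1)/(2m+2). Its square times (2m+3)/(2m+1) is the reciprocal of the new Wallis
  factor.\<close>

lemma central_binomial_wallis:
  "(real ((2*m) choose m) / 4^m)\<^sup>2 * (2 * real m + 1)
     * (\<Prod>k=1..m. (4 * real k ^ 2) / (4 * real k ^ 2 - 1)) = 1"
proof (induction m)
  case (Suc m)
  define c where "c = real ((2*m) choose m) / 4^m"
  have "(Suc m * Suc m) * ((2 * Suc m) choose Suc m) = (2 * Suc m) * (2 * m + 1) * ((2*m) choose m)"
  proof -
    have "Suc m * ((2 * Suc m) choose Suc m) = (2 * Suc m) * ((2*m + 1) choose m)"
      using Suc_times_binomial[of m "2*m+1"] by simp
    moreover have "Suc m * ((2*m+1) choose m) = (2*m+1) * ((2*m) choose m)"
      using binomial_absorb_comp[of "2*m+1" m] by (simp add: Suc_diff_le)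
    ultimately show ?thesis by (metis mult.assoc mult.left_commute)
  qed
  then have "real ((Suc m * Suc m) * ((2 * Suc m) choose Suc m)) = real ((2 * Suc m) * (2 * m + 1) * ((2*m) choose m))"
    by presburger
  then have "(real m + 1) * ((real m + 1) * real ((2 * Suc m) choose Suc m))
      = (real m + 1) * (2 * (2 * real m + 1) * real ((2*m) choose m))"
    by (simp add: algebra_simps)
  then have "(real m + 1) * real ((2 * Suc m) choose Suc m) = 2 * (2 * real m + 1) * real ((2*m) choose m)"
    by (subst (asm) mult_left_cancel) auto
  then have b: "real ((2 * Suc m) choose Suc m) = 2 * (2 * real m + 1) * real ((2*m) choose m) / (real m + 1)"
    by (subst nonzero_eq_divide_eq) (auto simp: mult.commute)
  have c: "real ((2 * Suc m) choose Suc m) / 4 ^ Suc m = (2 * real m + 1) / (2 * real m + 2) * c"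
    unfolding b c_def by (simp add: divide_simps) (simp add: algebra_simps)
  have f: "4 * real (Suc m) ^ 2 / (4 * real (Suc m) ^ 2 - 1) = (2 * real m + 2)^2 / ((2 * real m + 1) * (2 * real m + 3))"
    by (simp add: power2_eq_square algebra_simps)
  \<comment> \<open>Used with x, y, z equal to 2m+1, 2m+2, 2m+3 and \<open>p\<close> the Wallis
    product up to \<open>m\<close>.\<close>
  have alg: "(x / y * c)\<^sup>2 * z * (p * (y^2 / (x * z))) = c\<^sup>2 * x * p" if "x > 0" "y > 0" "z > 0" for x y z p :: real
    using that by (simp add: field_simps power2_eq_square)
  have p: "(\<Prod>k=1..Suc m. (4 * real k ^ 2) / (4 * real k ^ 2 - 1))
      = (\<Prod>k=1..m. (4 * real k ^ 2) / (4 * real k ^ 2 - 1)) * ((2 * real m + 2)^2 / ((2 * real m + 1) * (2 * real m + 3)))"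
    unfolding f[symmetric] by (subst prod.nat_ivl_Suc') (simp_all del: of_nat_Suc)
  have z: "2 * real (Suc m) + 1 = 2 * real m + 3" by simp
  show ?case unfolding c p z
    by (subst alg) (use Suc in \<open>auto simp: c_def\<close>)
qed simp

text \<open>All factors are at least 1, so the partial products increase to their limit.\<close>

lemma wallis_le: "(\<Prod>k=1..m. (4 * real k ^ 2) / (4 * real k ^ 2 - 1)) \<le> pi / 2"
proof (rule LIMSEQ_le_const[OF wallis], intro exI allI impI)
  fix n assume "n \<ge> m"
  have "1 \<le> (4 * real k ^ 2) / (4 * real k ^ 2 - 1)" if "k \<ge> 1" for k
  proof -
    have "real k ^ 2 \<ge> 1" using that by simp
    then show ?thesis by (simp add: field_simps)
  qed
  then show "(\<Prod>k=1..m. (4 * real k ^ 2) / (4 * real k ^ 2 - 1)) \<le> (\<Prod>k=1..n. (4 * real k ^ 2) / (4 * real k ^ 2 - 1))"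
    using \<open>n \<ge> m\<close> by (intro prod_mono2) (auto intro: order_trans[of 0 1])
qed

text \<open>Bounding the product by pi/2 in the exact identity gives an estimate for every
  \<open>m\<close>, with 2m+1 being the order of the bordered matrix.\<close>

lemma central_binomial_ge:
  "sqrt (2 / (pi * (2 * real m + 1))) \<le> real ((2*m) choose m) / 4^m"
proof (rule real_le_lsqrt)
  let ?c = "real ((2*m) choose m) / 4^m"
  have "1 \<le> ?c\<^sup>2 * (2 * real m + 1) * (pi / 2)"
    using mult_left_mono[OF wallis_le[of m], of "?c\<^sup>2 * (2 * real m + 1)"]
    unfolding central_binomial_wallis by simp
  then have "2 \<le> ?c\<^sup>2 * (pi * (2 * real m + 1))"
    by (simp add: mult_ac)
  then show "2 / (pi * (2 * real m + 1)) \<le> ?c\<^sup>2"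
    by (subst pos_divide_le_eq) (auto intro: mult_pos_pos add_nonneg_pos)
qed (auto)

section \<open>Row orthogonalisation and Hadamard's inequality\<close>

abbreviation row_dot :: "nat \<Rightarrow> real mat \<Rightarrow> nat \<Rightarrow> nat \<Rightarrow> real" where
  "row_dot n A i j \<equiv> (\<Sum>c<n. A $$ (i, c) * A $$ (j, c))"

lemma gram_index:
  assumes "A \<in> carrier_mat n n" "i < n" "j < n"
  shows "(A * A\<^sup>T) $$ (i, j) = row_dot n A i j"
  using assms by (simp add: scalar_prod_def atLeast0LessThan)

text \<open>The Gram matrix has determinant (det A)^2, and the hypothesis makes it
  triangular.\<close>

lemma det_orthogonal_rows:
  assumes A: "A \<in> carrier_mat n n"
    and orth: "\<And>i j. i < n \<Longrightarrow> j < i \<Longrightarrow> row_dot n A i j = 0"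
  shows "(det A)\<^sup>2 = (\<Prod>i<n. row_dot n A i i)"
proof -
  let ?G = "A * A\<^sup>T"
  have G: "?G \<in> carrier_mat n n" using A by simp
  have "upper_triangular ?G"
    unfolding upper_triangular_def using A gram_index[OF A] orth by auto
  then have "det ?G = (\<Prod>i<n. ?G $$ (i, i))"
    using A by (simp add: det_upper_triangular[OF _ G] prod_list_diag_prod atLeast0LessThan del: index_mult_mat(1))
  moreover have "det ?G = (det A)\<^sup>2"
    using A by (simp add: det_mult[OF A] det_transpose[OF A] power2_eq_square)
  ultimately show ?thesis using gram_index[OF A] by simp
qed

text \<open>A zero row \<open>l\<close> is harmless: \<open>x / 0 = 0\<close>, and both rows are already orthogonal.\<close>

lemma row_dot_projection:
  fixes A :: "real mat"
  assumes A: "A \<in> carrier_mat n n" and kl: "k < n" "l < n" "k \<noteq> l"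
  defines "B \<equiv> addrow (- row_dot n A k l / row_dot n A l l) k l A"
  shows "B \<in> carrier_mat n n" "det B = det A"
    and "\<And>i j. i < n \<Longrightarrow> j < n \<Longrightarrow> i \<noteq> k \<Longrightarrow> j \<noteq> k \<Longrightarrow> row_dot n B i j = row_dot n A i j"
    and "\<And>j. j < n \<Longrightarrow> j \<noteq> k \<Longrightarrow>
           row_dot n B k j = row_dot n A k j - row_dot n A k l / row_dot n A l l * row_dot n A l j"
    and "row_dot n B k l = 0"
    and "row_dot n B k k = row_dot n A k k - (row_dot n A k l)\<^sup>2 / row_dot n A l l"
proof -
  let ?q = "row_dot n A k l / row_dot n A l l"
  show "B \<in> carrier_mat n n" using A by (simp add: B_def)
  show "det B = det A" unfolding B_def using kl A by (intro det_addrow) auto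
  have ent: "B $$ (i, c) = (if i = k then A $$ (k, c) - ?q * A $$ (l, c) else A $$ (i, c))"
    if "i < n" "c < n" for i c
    using that A kl by (auto simp: B_def)
  show "row_dot n B i j = row_dot n A i j" if "i < n" "j < n" "i \<noteq> k" "j \<noteq> k" for i j
    using that ent by (intro sum.cong) auto
  show gen: "row_dot n B k j = row_dot n A k j - ?q * row_dot n A l j"
    if "j < n" "j \<noteq> k" for j
  proof -
    have "row_dot n B k j = (\<Sum>c<n. A $$ (k, c) * A $$ (j, c) - ?q * (A $$ (l, c) * A $$ (j, c)))"
      using that ent kl by (intro sum.cong) (auto simp: left_diff_distrib)
    then show ?thesis by (simp only: sum_subtractf sum_distrib_left)
  qed
  have zero: "row_dot n A k l = 0" if "row_dot n A l l = 0"
  proof -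
    have "A $$ (l, c) = 0" if "c < n" for c
      using \<open>row_dot n A l l = 0\<close> that by (subst (asm) sum_nonneg_eq_0_iff) auto
    then show ?thesis by simp
  qed
  show "row_dot n B k l = 0" using gen[of l] kl zero by auto
  have "row_dot n B k k = (\<Sum>c<n. (A $$ (k, c) - ?q * A $$ (l, c))\<^sup>2)"
    using ent kl by (intro sum.cong) (auto simp: power2_eq_square)
  also have "\<dots> = (\<Sum>c<n. A $$ (k, c) * A $$ (k, c) - 2 * ?q * (A $$ (k, c) * A $$ (l, c))
      + ?q\<^sup>2 * (A $$ (l, c) * A $$ (l, c)))"
    by (intro sum.cong) (auto simp: power2_eq_square algebra_simps)
  also have "\<dots> = row_dot n A k k - 2 * ?q * row_dot n A k l + ?q\<^sup>2 * row_dot n A l l"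
    by (simp only: sum_subtractf sum.distrib sum_distrib_left)
  also have "\<dots> = row_dot n A k k - (row_dot n A k l)\<^sup>2 / row_dot n A l l"
    using zero by (cases "row_dot n A l l = 0") (simp_all add: power2_eq_square)
  finally show "row_dot n B k k = row_dot n A k k - (row_dot n A k l)\<^sup>2 / row_dot n A l l" .
qed

lemma row_dot_self_nonneg: "row_dot n A i i \<ge> 0"
  by (intro sum_nonneg) auto

text \<open>Gram-Schmidt without normalisation: subtracting a projection keeps the determinant and
  never lengthens a row.\<close>

lemma gram_schmidt_rows:
  fixes A :: "real mat"
  assumes A: "A \<in> carrier_mat n n" and "k \<le> n"
  shows "\<exists>B \<in> carrier_mat n n. det B = det A \<and> (\<forall>i<n. row_dot n B i i \<le> row_dot n A i i)
           \<and> (\<forall>i<k. \<forall>j<i. row_dot n B i j = 0)"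
  using \<open>k \<le> n\<close>
proof (induction k)
  case (Suc k)
  \<comment> \<open>Row \<open>k\<close> is projected off the rows before it one at a time;
    \<open>P B l\<close> says that rows below \<open>l\<close> are done.\<close>
  define P where "P B l \<longleftrightarrow> B \<in> carrier_mat n n \<and> det B = det A \<and> (\<forall>i<n. row_dot n B i i \<le> row_dot n A i i)
    \<and> (\<forall>i<k. \<forall>j<i. row_dot n B i j = 0) \<and> (\<forall>j<l. row_dot n B k j = 0)" for B l
  have "\<exists>B. P B l" if "l \<le> k" for l
    using that
  proof (induction l)
    case 0
    then show ?case using Suc by (auto simp: P_def)
  next
    case (Suc l)
    then obtain B where B: "B \<in> carrier_mat n n" "det B = det A" "\<And>i. i < n \<Longrightarrow> row_dot n B i i \<le> row_dot n A i i"
      "\<And>i j. i < k \<Longrightarrow> j < i \<Longrightarrow> row_dot n B i j = 0" "\<And>j. j < l \<Longrightarrow> row_dot n B k j = 0"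
      unfolding P_def by auto
    have kl: "k < n" "l < n" "k \<noteq> l" "l < k" using Suc.prems \<open>Suc k \<le> n\<close> by auto
    define C where "C = addrow (- row_dot n B k l / row_dot n B l l) k l B"
    note C = row_dot_projection[OF B(1) kl(1-3), folded C_def]
    have "row_dot n C i i \<le> row_dot n A i i" if "i < n" for i
    proof (cases "i = k")
      case True
      have "(row_dot n B k l)\<^sup>2 / row_dot n B l l \<ge> 0"
        using row_dot_self_nonneg[of B l n] by simp
      then show ?thesis using True C(6) B(3)[OF that] by simp
    next
      case False
      then show ?thesis using C(3)[of i i] B(3)[OF that] that by simp
    qed
    moreover have "row_dot n C i j = 0" if "i < k" "j < i" for i j
      using C(3)[of i j] B(4)[OF that] that kl by simp
    moreover have "row_dot n C k j = 0" if "j < Suc l" for j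
    proof (cases "j = l")
      case False
      then have "j < l" using that by simp
      \<comment> \<open>Rows \<open>l\<close> and \<open>j\<close> are already orthogonal, so
        subtracting a multiple of row \<open>l\<close> does not disturb the zero at
        \<open>j\<close>.\<close>
      then show ?thesis using C(4)[of j] B(4)[of l j] B(5)[of j] kl by simp
    qed (use C(5) in simp)
    ultimately have "P C (Suc l)" using C(1,2) B(2) by (simp add: P_def)
    then show ?case ..
  qed
  from this[of k] obtain B where "P B k" by auto
  then show ?case
    by (intro bexI[of _ B]) (auto simp: P_def less_Suc_eq)
qed (use A in auto)

theorem hadamard_inequality:
  fixes A :: "real mat"
  assumes A: "A \<in> carrier_mat n n"
  shows "(det A)\<^sup>2 \<le> (\<Prod>i<n. row_dot n A i i)"
proof -
  obtain B where B: "B \<in> carrier_mat n n" "det B = det A" "\<forall>i<n. row_dot n B i i \<le> row_dot n A i i"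
    "\<forall>i<n. \<forall>j<i. row_dot n B i j = 0"
    using gram_schmidt_rows[OF A order.refl] by auto
  have "(det A)\<^sup>2 = (\<Prod>i<n. row_dot n B i i)"
    using det_orthogonal_rows[OF B(1)] B by simp
  also have "\<dots> \<le> (\<Prod>i<n. row_dot n A i i)"
    using B(3) row_dot_self_nonneg by (intro prod_mono) auto
  finally show ?thesis .
qed

text \<open>Otherwise one projection would strictly shorten row \<open>k\<close> at unchanged
  determinant, and the new matrix would violate Hadamard's inequality.\<close>

lemma hadamard_equality:
  fixes A :: "real mat"
  assumes A: "A \<in> carrier_mat n n" and eq: "(det A)\<^sup>2 = (\<Prod>i<n. row_dot n A i i)" and "det A \<noteq> 0"
    and kl: "k < n" "l < n" "k \<noteq> l"
  shows "row_dot n A k l = 0"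
proof (rule ccontr)
  assume nz: "row_dot n A k l \<noteq> 0"
  have pos: "row_dot n A i i > 0" if "i < n" for i
  proof -
    have "row_dot n A i i \<noteq> 0"
    proof
      assume "row_dot n A i i = 0"
      then have "(\<Prod>i<n. row_dot n A i i) = 0" using that by (intro prod_zero) auto
      with eq have "(det A)\<^sup>2 = 0" by (rule trans)
      then show False using \<open>det A \<noteq> 0\<close> by simp
    qed
    then show ?thesis using row_dot_self_nonneg[of A i n] by linarith
  qed
  define C where "C = addrow (- row_dot n A k l / row_dot n A l l) k l A"
  note C = row_dot_projection[OF A kl, folded C_def]
  have "row_dot n C k k < row_dot n A k k"
    using C(6) nz pos[OF kl(2)] by simp
  then have "row_dot n C k k * (\<Prod>i\<in>{..<n}-{k}. row_dot n A i i) < row_dot n A k k * (\<Prod>i\<in>{..<n}-{k}. row_dot n A i i)"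
    using pos by (intro mult_strict_right_mono prod_pos) auto
  moreover have "(\<Prod>i\<in>{..<n}-{k}. row_dot n C i i) = (\<Prod>i\<in>{..<n}-{k}. row_dot n A i i)"
    using C(3) by (intro prod.cong) auto
  ultimately have "(\<Prod>i<n. row_dot n C i i) < (\<Prod>i<n. row_dot n A i i)"
    using kl by (simp add: prod.remove[of "{..<n}" k])
  with hadamard_inequality[OF C(1)] C(2) eq show False by simp
qed

section \<open>Hadamard matrices and their minors\<close>

lemma sign_square: "x \<in> {1, -1} \<Longrightarrow> x * x = (1::real)"
  by auto

text \<open>Rows of signs have squared norm \<open>h\<close>, so (det M)^2 = h^h is the equality
  case of Hadamard's inequality.\<close>

lemma hadamard_matrix_gram:
  assumes H: "hadamard_matrix h M" and "h > 0"
  shows "M * M\<^sup>T = real h \<cdot>\<^sub>m 1\<^sub>m h" "M\<^sup>T * M = real h \<cdot>\<^sub>m 1\<^sub>m h"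
proof -
  have M: "M \<in> carrier_mat h h" and ent: "\<And>i j. i < h \<Longrightarrow> j < h \<Longrightarrow> M $$ (i, j) \<in> {1, -1}"
    and d: "\<bar>det M\<bar> = real h powr (real h / 2)"
    using H by (auto simp: hadamard_matrix_def sign_matrices_def)
  have diag: "row_dot h M i i = real h" if "i < h" for i
    using sign_square[OF ent[OF that]] by simp
  have "(det M)\<^sup>2 = (real h powr (real h / 2))\<^sup>2" using d by (metis power2_abs)
  also have "\<dots> = real h ^ h" using \<open>h > 0\<close>
    by (simp add: power2_eq_square powr_realpow flip: powr_add)
  finally have eq: "(det M)\<^sup>2 = (\<Prod>i<h. row_dot h M i i)" using diag by simp
  have nz: "det M \<noteq> 0" using d \<open>h > 0\<close> by auto
  show *: "M * M\<^sup>T = real h \<cdot>\<^sub>m 1\<^sub>m h"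
  proof (rule eq_matI)
    fix i j assume "i < dim_row (real h \<cdot>\<^sub>m 1\<^sub>m h)" "j < dim_col (real h \<cdot>\<^sub>m 1\<^sub>m h)"
    then show "(M * M\<^sup>T) $$ (i, j) = (real h \<cdot>\<^sub>m 1\<^sub>m h) $$ (i, j)"
      using gram_index[OF M, of i j] diag hadamard_equality[OF M eq nz, of i j] by auto
  qed (use M in auto)
  have T: "M\<^sup>T \<in> carrier_mat h h" using M by simp
  \<comment> \<open>The column version follows because a right inverse of a square matrix is a left
    inverse.\<close>
  have "M * ((1 / real h) \<cdot>\<^sub>m M\<^sup>T) = 1\<^sub>m h"
    using \<open>h > 0\<close> by (simp add: mult_smult_distrib[OF M T] *) (auto intro!: eq_matI)
  then have "((1 / real h) \<cdot>\<^sub>m M\<^sup>T) * M = 1\<^sub>m h"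
    using M by (intro mat_mult_left_right_inverse[OF M]) simp_all
  then have "(1 / real h) \<cdot>\<^sub>m (M\<^sup>T * M) = 1\<^sub>m h"
    by (simp add: mult_smult_assoc_mat[OF T M])
  then have "real h \<cdot>\<^sub>m ((1 / real h) \<cdot>\<^sub>m (M\<^sup>T * M)) = real h \<cdot>\<^sub>m 1\<^sub>m h" by simp
  moreover have "real h \<cdot>\<^sub>m ((1 / real h) \<cdot>\<^sub>m (M\<^sup>T * M)) = M\<^sup>T * M"
    using \<open>h > 0\<close> by (intro eq_matI) auto
  ultimately show "M\<^sup>T * M = real h \<cdot>\<^sub>m 1\<^sub>m h" by simp
qed

text \<open>Negating row 0 flips the sign of the determinant, so later constructions need only its
  absolute value.\<close>

lemma max_det_ge_abs:
  assumes M: "M \<in> sign_matrices n" and "n > 0"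
  shows "\<bar>det M\<bar> \<le> max_det n"
proof -
  have "multrow 0 (-1) M \<in> sign_matrices n"
  proof -
    have "M \<in> carrier_mat n n" and "\<And>i j. i < n \<Longrightarrow> j < n \<Longrightarrow> M $$ (i, j) = 1 \<or> M $$ (i, j) = -1"
      using M by (auto simp: sign_matrices_def)
    then show ?thesis by (fastforce simp: sign_matrices_def)
  qed
  moreover have "det (multrow 0 (-1) M) = - det M"
    using det_multrow[of 0 n M "-1"] M \<open>n > 0\<close> by (auto simp: sign_matrices_def)
  ultimately show ?thesis using det_le_max_det[OF M] det_le_max_det by force
qed

lemma max_det_hadamard_minor:
  assumes H: "hadamard_matrix (Suc n) M" and "n > 0"
  shows "max_det n \<ge> (real n + 1) powr ((real n - 1) / 2)"
proof -
  let ?h = "Suc n"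
  have M: "M \<in> carrier_mat ?h ?h" and ent: "\<And>i j. i < ?h \<Longrightarrow> j < ?h \<Longrightarrow> M $$ (i, j) \<in> {1, -1}"
    and d: "\<bar>det M\<bar> = real ?h powr (real ?h / 2)"
    using H by (auto simp: hadamard_matrix_def sign_matrices_def)
  have T: "M\<^sup>T \<in> carrier_mat ?h ?h" using M by simp
  \<comment> \<open>The product M^T M adj(M) is bracketed in both ways; its (0,0) entry then yields
    a minor.\<close>
  have "real ?h \<cdot>\<^sub>m adj_mat M = (M\<^sup>T * M) * adj_mat M"
    using adj_mat(1)[OF M] hadamard_matrix_gram(2)[OF H]
    by (simp add: mult_smult_assoc_mat[OF one_carrier_mat adj_mat(1)[OF M]])
  also have "\<dots> = M\<^sup>T * (M * adj_mat M)"
    using M adj_mat(1)[OF M] by (intro assoc_mult_mat) auto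
  also have "\<dots> = det M \<cdot>\<^sub>m M\<^sup>T"
    using M T by (simp add: adj_mat(2)[OF M] mult_smult_distrib[OF T one_carrier_mat] right_mult_one_mat[OF T])
  finally have "(real ?h \<cdot>\<^sub>m adj_mat M) $$ (0, 0) = (det M \<cdot>\<^sub>m M\<^sup>T) $$ (0, 0)" by simp
  then have "real ?h * det (mat_delete M 0 0) = det M * M $$ (0, 0)"
    using M by (simp add: adj_mat_def cofactor_def)
  then have "\<bar>real ?h * det (mat_delete M 0 0)\<bar> = \<bar>det M * M $$ (0, 0)\<bar>" by (rule arg_cong)
  moreover have "\<bar>M $$ (0, 0)\<bar> = 1" using ent[of 0 0] by auto
  ultimately have "real ?h * \<bar>det (mat_delete M 0 0)\<bar> = \<bar>det M\<bar>"
    unfolding abs_mult by simp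
  then have "\<bar>det (mat_delete M 0 0)\<bar> = real ?h powr (real ?h / 2) / real ?h"
    unfolding d by (simp add: field_simps)
  also have "\<dots> = real ?h powr (real ?h / 2 - 1)"
    by (subst powr_diff) simp
  also have "real ?h / 2 - 1 = (real n - 1) / 2"
    by (simp add: add_divide_distrib diff_divide_distrib)
  also have "real ?h = real n + 1" by simp
  finally have "\<bar>det (mat_delete M 0 0)\<bar> = (real n + 1) powr ((real n - 1) / 2)" .
  moreover have "mat_delete M 0 0 \<in> sign_matrices n"
    using M ent by (auto simp: sign_matrices_def mat_delete_def)
  ultimately show ?thesis using max_det_ge_abs \<open>n > 0\<close> by metis
qed

section \<open>Bordered matrices\<close>

definition bordered_mat :: "nat \<Rightarrow> real mat \<Rightarrow> (nat \<Rightarrow> real) \<Rightarrow> (nat \<Rightarrow> real) \<Rightarrow> real \<Rightarrow> real mat" where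
  "bordered_mat n A c r s = four_block_mat A (mat n 1 (\<lambda>(i, j). c i)) (mat 1 n (\<lambda>(i, j). r j)) (mat 1 1 (\<lambda>_. s))"

lemma bordered_mat_sign:
  assumes "A \<in> sign_matrices n" "\<And>i. i < n \<Longrightarrow> c i \<in> {1, -1}" "\<And>i. i < n \<Longrightarrow> r i \<in> {1, -1}" "s \<in> {1, -1}"
  shows "bordered_mat n A c r s \<in> sign_matrices (Suc n)"
proof -
  have A: "A \<in> carrier_mat n n" using assms by (simp add: sign_matrices_def)
  have "bordered_mat n A c r s $$ (i, j) \<in> {1, -1}" if "i < Suc n" "j < Suc n" for i j
  proof -
    have "bordered_mat n A c r s $$ (i, j)
        = (if i < n then if j < n then A $$ (i, j) else c i else if j < n then r j else s)"
      using that A by (auto simp: bordered_mat_def)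
    moreover have "i < n \<Longrightarrow> j < n \<Longrightarrow> A $$ (i, j) \<in> {1, -1}"
      using assms(1) by (simp add: sign_matrices_def)
    ultimately show ?thesis using assms(2-4) by presburger
  qed
  moreover have "bordered_mat n A c r s \<in> carrier_mat (Suc n) (Suc n)"
    using A by (auto simp: bordered_mat_def)
  ultimately show ?thesis unfolding sign_matrices_def by blast
qed

text \<open>The Schur complement formula, with a solution \<open>w\<close> of A w = c standing for
  the inverse of \<open>A\<close> applied to \<open>c\<close>.\<close>

lemma det_bordered_mat:
  assumes A: "A \<in> carrier_mat n n" and w: "\<And>i. i < n \<Longrightarrow> (\<Sum>j<n. A $$ (i, j) * w j) = c i"
  shows "det (bordered_mat n A c r s) = det A * (s - (\<Sum>j<n. r j * w j))"
proof -
  let ?C = "mat n 1 (\<lambda>(i, j). c i)" and ?R = "mat 1 n (\<lambda>(i, j). r j)" and ?S = "mat 1 1 (\<lambda>_. s)"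
  let ?W = "mat n 1 (\<lambda>(i, j). - w i)"
  let ?t = "s - (\<Sum>j<n. r j * w j)"
  \<comment> \<open>Right multiplication by \<open>?N\<close> subtracts \<open>w j\<close> times
    column \<open>j\<close> from the last column, clearing it above the corner.\<close>
  let ?N = "four_block_mat (1\<^sub>m n) ?W (0\<^sub>m 1 n) (1\<^sub>m 1)"
  have "bordered_mat n A c r s * ?N = four_block_mat (A * 1\<^sub>m n + ?C * 0\<^sub>m 1 n) (A * ?W + ?C * 1\<^sub>m 1)
      (?R * 1\<^sub>m n + ?S * 0\<^sub>m 1 n) (?R * ?W + ?S * 1\<^sub>m 1)"
    unfolding bordered_mat_def using A by (intro mult_four_block_mat) auto
  also have "A * 1\<^sub>m n + ?C * 0\<^sub>m 1 n = A" using A by simp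
  also have "A * ?W + ?C * 1\<^sub>m 1 = 0\<^sub>m n 1"
    using A w by (intro eq_matI) (auto simp: scalar_prod_def atLeast0LessThan sum_negf)
  also have "?R * 1\<^sub>m n + ?S * 0\<^sub>m 1 n = ?R" using A by simp
  also have "?R * ?W + ?S * 1\<^sub>m 1 = mat 1 1 (\<lambda>_. ?t)"
    by (intro eq_matI) (auto simp: scalar_prod_def atLeast0LessThan sum_negf)
  finally have "bordered_mat n A c r s * ?N = four_block_mat A (0\<^sub>m n 1) ?R (mat 1 1 (\<lambda>_. ?t))" .
  then have "det (bordered_mat n A c r s * ?N) = det A * det (mat 1 1 (\<lambda>_. ?t))"
    using A by (simp add: det_four_block_mat_upper_right_zero)
  moreover have "det ?N = 1"
    by (subst det_four_block_mat_lower_left_zero[of _ n _ 1]) auto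
  moreover have "det (bordered_mat n A c r s * ?N) = det (bordered_mat n A c r s) * det ?N"
    using A by (intro det_mult[of _ "Suc n"]) (auto simp: bordered_mat_def)
  moreover have "det (mat 1 1 (\<lambda>_. ?t)) = ?t" by (subst det_single) auto
  ultimately show ?thesis by simp
qed

lemma max_det_Suc:
  assumes "n > 0"
  shows "max_det (Suc n) \<ge> 2 * max_det n"
proof -
  obtain A where A: "A \<in> sign_matrices n" and d: "det A = max_det n"
    using max_det_attained by blast
  then have car: "A \<in> carrier_mat n n" and ent: "\<And>i j. i < n \<Longrightarrow> j < n \<Longrightarrow> A $$ (i, j) \<in> {1, -1}"
    by (auto simp: sign_matrices_def)
  let ?B = "bordered_mat n A (\<lambda>i. A $$ (i, 0)) (\<lambda>j. A $$ (0, j)) (- A $$ (0, 0))"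
  \<comment> \<open>The border column copies column 0, so \<open>w\<close> is the first unit vector
    and the Schur complement is -2 times the (0,0) entry.\<close>
  have "det ?B = det A * (- A $$ (0, 0) - (\<Sum>j<n. A $$ (0, j) * (if j = 0 then 1 else 0)))"
    using assms by (intro det_bordered_mat[OF car]) (simp add: if_distrib[of "(*) _"] cong: if_cong)
  also have "\<dots> = - 2 * A $$ (0, 0) * det A"
    using assms by (simp add: if_distrib[of "(*) _"] cong: if_cong)
  finally have "\<bar>det ?B\<bar> = 2 * \<bar>det A\<bar>" using ent[of 0 0] assms by auto
  moreover have "?B \<in> sign_matrices (Suc n)"
    using ent[OF _ assms] ent[OF assms] ent[OF assms assms] by (intro bordered_mat_sign[OF A]) force+
  ultimately show ?thesis using max_det_ge_abs[of ?B "Suc n"] d by simp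
qed

section \<open>Best's averaging argument and the border of a Hadamard matrix\<close>

text \<open>By \<open>sum_signings\<close> every row has the same total over all 4^m sign vectors;
  the bound is the resulting average, which some \<open>x\<close> attains or exceeds.\<close>

lemma excess_lower_bound:
  assumes M: "M \<in> sign_matrices (2*m)"
  obtains x where "\<And>j. x j \<in> {1, -1 :: real}"
    and "(\<Sum>i<2*m. \<bar>\<Sum>j<2*m. M $$ (i, j) * x j\<bar>) \<ge> 2 * real m * (2 * real m * (real ((2*m) choose m) / 4^m))"
proof -
  let ?x = "\<lambda>X j. if j \<in> X then 1 else -1 :: real"
  let ?F = "\<lambda>X. \<Sum>i<2*m. \<bar>\<Sum>j<2*m. M $$ (i, j) * ?x X j\<bar>"
  let ?b = "2 * real m * (2 * real m * (real ((2*m) choose m) / 4^m))"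
  have "(\<Sum>X\<in>Pow {..<2*m}. ?F X) = (\<Sum>i<2*m. \<Sum>X\<in>Pow {..<2*m}. \<bar>\<Sum>j<2*m. M $$ (i, j) * ?x X j\<bar>)"
    by (rule sum.swap)
  also have "\<dots> = (\<Sum>i<2*m. 2 * real m * real ((2*m) choose m))"
  proof (rule sum.cong[OF refl])
    fix i assume "i \<in> {..<2*m}"
    then have "\<And>j. j \<in> {..<2*m} \<Longrightarrow> M $$ (i, j) \<in> {1, -1}"
      using M by (simp add: sign_matrices_def)
    then show "(\<Sum>X\<in>Pow {..<2*m}. \<bar>\<Sum>j<2*m. M $$ (i, j) * ?x X j\<bar>) = 2 * real m * real ((2*m) choose m)"
      using sum_signings[of "{..<2*m}" "\<lambda>j. M $$ (i, j)" abs] sum_binomial_abs[of m] by simp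
  qed
  finally have total: "(\<Sum>X\<in>Pow {..<2*m}. ?F X) = 4^m * ?b" by simp
  have "\<exists>X\<in>Pow {..<2*m}. ?F X \<ge> ?b"
  proof (rule ccontr)
    assume "\<not> ?thesis"
    then have "(\<Sum>X\<in>Pow {..<2*m}. ?F X) < (\<Sum>X\<in>Pow {..<2*m}. ?b)"
      by (intro sum_strict_mono) (auto simp: not_le)
    also have "\<dots> = 4^m * ?b" by (simp add: card_Pow power_mult)
    finally show False using total by simp
  qed
  then obtain X where "?F X \<ge> ?b" by blast
  then show thesis using that[of "?x X"] by auto
qed

lemma max_det_hadamard_border:
  assumes H: "hadamard_matrix (2*m) M" and "m > 0"
  shows "max_det (Suc (2*m)) \<ge> real (2*m) powr real m * (1 + 2 * real m * (real ((2*m) choose m) / 4^m))"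
proof -
  let ?h = "2 * m"
  have S: "M \<in> sign_matrices ?h" and M: "M \<in> carrier_mat ?h ?h"
    and d: "\<bar>det M\<bar> = real ?h powr real m"
    using H by (auto simp: hadamard_matrix_def sign_matrices_def)
  obtain x where x: "\<And>j. x j \<in> {1, -1 :: real}"
    and big: "(\<Sum>i<?h. \<bar>\<Sum>j<?h. M $$ (i, j) * x j\<bar>) \<ge> 2 * real m * (2 * real m * (real (?h choose m) / 4^m))"
    using excess_lower_bound[OF S] by blast
  \<comment> \<open>The value at a zero sum is 1, not 0, so that \<open>y\<close> is a legitimate
    border column.\<close>
  define y where "y i = (if (\<Sum>j<?h. M $$ (i, j) * x j) \<ge> 0 then 1 else -1 :: real)" for i
  \<comment> \<open>This is M^T y / h, which solves M w = y because M M^T = h I.\<close>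
  define w where "w j = (\<Sum>i<?h. M $$ (i, j) * y i) / real ?h" for j
  have gram: "row_dot ?h M i k = (if i = k then real ?h else 0)" if "i < ?h" "k < ?h" for i k
  proof -
    have "row_dot ?h M i k = (real ?h \<cdot>\<^sub>m 1\<^sub>m ?h) $$ (i, k)"
      unfolding gram_index[OF M that, symmetric] using hadamard_matrix_gram(1)[OF H] \<open>m > 0\<close> by simp
    then show ?thesis using that by simp
  qed
  have w: "(\<Sum>j<?h. M $$ (i, j) * w j) = y i" if "i < ?h" for i
  proof -
    have "(\<Sum>j<?h. M $$ (i, j) * w j) = (\<Sum>j<?h. \<Sum>k<?h. y k * (M $$ (i, j) * M $$ (k, j))) / real ?h"
      unfolding w_def sum_divide_distrib
      by (simp add: sum_distrib_left sum_divide_distrib mult_ac)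
    also have "(\<Sum>j<?h. \<Sum>k<?h. y k * (M $$ (i, j) * M $$ (k, j))) = (\<Sum>k<?h. y k * row_dot ?h M i k)"
      unfolding sum_distrib_left by (rule sum.swap)
    also have "\<dots> = (\<Sum>k<?h. if k = i then y k * real ?h else 0)"
      using gram that by (intro sum.cong) auto
    also have "\<dots> / real ?h = y i" using that \<open>m > 0\<close> by simp
    finally show ?thesis .
  qed
  \<comment> \<open>Exchanging sums turns x^T w into y^T M x / h, where the signs in
    \<open>y\<close> produce absolute values.\<close>
  have "(\<Sum>j<?h. x j * w j) = (\<Sum>j<?h. \<Sum>i<?h. y i * (M $$ (i, j) * x j)) / real ?h"
    unfolding w_def by (simp add: sum_distrib_left sum_divide_distrib mult_ac)
  also have "(\<Sum>j<?h. \<Sum>i<?h. y i * (M $$ (i, j) * x j)) = (\<Sum>i<?h. y i * (\<Sum>j<?h. M $$ (i, j) * x j))"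
    unfolding sum_distrib_left by (rule sum.swap)
  also have "\<dots> = (\<Sum>i<?h. \<bar>\<Sum>j<?h. M $$ (i, j) * x j\<bar>)"
    by (intro sum.cong) (auto simp: y_def)
  finally have "(\<Sum>j<?h. x j * w j) = (\<Sum>i<?h. \<bar>\<Sum>j<?h. M $$ (i, j) * x j\<bar>) / real ?h" .
  then have xw: "(\<Sum>j<?h. x j * w j) \<ge> 2 * real m * (real (?h choose m) / 4^m)"
    using big \<open>m > 0\<close> by (simp add: pos_le_divide_eq mult.commute)
  let ?B = "bordered_mat ?h M y (\<lambda>j. - x j) 1"
  have "det ?B = det M * (1 + (\<Sum>j<?h. x j * w j))"
    using det_bordered_mat[OF M w] by (simp add: sum_negf)
  then have "\<bar>det ?B\<bar> = real ?h powr real m * \<bar>1 + (\<Sum>j<?h. x j * w j)\<bar>"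
    by (simp only: abs_mult d)
  moreover have "real ?h powr real m * (1 + 2 * real m * (real (?h choose m) / 4^m))
      \<le> real ?h powr real m * \<bar>1 + (\<Sum>j<?h. x j * w j)\<bar>"
    using xw by (intro mult_left_mono) auto
  moreover have "?B \<in> sign_matrices (Suc ?h)"
    using x by (intro bordered_mat_sign[OF S]) (auto simp: y_def)
  ultimately show ?thesis using max_det_ge_abs[of ?B "Suc ?h"] by simp
qed

section \<open>Estimates for the residue classes modulo 4\<close>

text \<open>This is (1 + 1/k)^k \<le> e after taking square roots. Each increase of the order by one
  costs this factor e^(-1/2).\<close>

lemma powr_half_Suc_le:
  fixes k :: real
  assumes "k > 0"
  shows "exp (- 1 / 2) * (k + 1) powr (k / 2) \<le> k powr (k / 2)"
proof -
  have "k + 1 = k * (1 + 1 / k)" using assms by (simp add: field_simps)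
  also have "\<dots> \<le> k * exp (1 / k)" using assms by (intro mult_left_mono exp_ge_add_one_self) auto
  finally have "(k + 1) powr (k / 2) \<le> (k * exp (1 / k)) powr (k / 2)"
    using assms by (intro powr_mono2) auto
  also have "\<dots> = k powr (k / 2) * exp (1 / 2)"
    using assms by (simp add: powr_mult exp_powr_real)
  finally show ?thesis by (simp add: exp_minus field_simps)
qed

lemma powr_half_eq: "real (Suc k) powr (real (Suc k) / 2) = (real k + 1) powr (real k / 2) * sqrt (real k + 1)"
proof -
  have "real (Suc k) = real k + 1" by simp
  then show ?thesis by (simp only: add_divide_distrib powr_add) (simp add: powr_half_sqrt)
qed

lemma exp_minus_half: "exp (- 1 / 2 :: real) = 1 / sqrt (exp 1)"
proof -
  have "sqrt (exp 1 :: real) = exp (1 / 2)"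
    by (intro real_sqrt_unique) (simp_all add: power2_eq_square flip: exp_add)
  then show ?thesis by (simp add: exp_minus field_simps)
qed

lemma max_det_ge_1_mod_4:
  assumes "hadamard_conjecture" and n: "n mod 4 = 1"
  shows "max_det n \<ge> sqrt (2 / (pi * exp 1)) * real n powr (real n / 2)"
\<comment> \<open>Order 1 would need a Hadamard matrix of order 0, which the conjecture does not
  supply.\<close>
proof (cases "n = 1")
  case True
  have "mat 1 1 (\<lambda>_. 1) \<in> sign_matrices 1" by (simp add: sign_matrices_def)
  from det_le_max_det[OF this] have "1 \<le> max_det 1" by (subst (asm) det_single) auto
  moreover have "1 * 2 \<le> exp 1 * pi" using pi_ge_two by (intro mult_mono) auto
  then have "sqrt (2 / (pi * exp 1)) \<le> 1" by (simp add: mult.commute)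
  ultimately have "sqrt (2 / (pi * exp 1)) \<le> max_det 1" by linarith
  then show ?thesis using True by simp
next
  case False
  define t where "t = n div 4"
  define m where "m = 2 * t"
  have nt: "n = Suc (2 * m)" and "t > 0" 
    using div_mult_mod_eq[of n 4] n False by (auto simp: m_def t_def)
  then obtain M where "hadamard_matrix (2 * m) M" and "m > 0"
    using assms(1) unfolding hadamard_conjecture_def m_def by auto
  note border = max_det_hadamard_border[OF this]
  define s where "s = sqrt (2 / pi)"
  define q where "q = sqrt (2 * real m + 1)"
  have s: "0 < s" "s \<le> 1" using pi_ge_two by (auto simp: s_def)
  have q: "1 \<le> q" "q * q = 2 * real m + 1" by (auto simp: q_def)
  have "s / q \<le> real ((2*m) choose m) / 4^m"
    using central_binomial_ge[of m] by (simp add: s_def q_def real_sqrt_divide real_sqrt_mult)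
  then have "2 * real m * (s / q) \<le> 2 * real m * (real ((2*m) choose m) / 4^m)"
    by (intro mult_left_mono) auto
  \<comment> \<open>Here q^2 = n = 2m+1, so the main term is sqrt (2n/pi). The loss s/q is at most 1
    and is absorbed by the corner entry 1.\<close>
  moreover have "2 * real m * (s / q) = s * q - s / q"
  proof -
    have "2 * real m = q * q - 1" using q by simp
    moreover have "(q * q - 1) * (s / q) = s * q - s / q" using q(1) by (simp add: field_simps)
    ultimately show ?thesis by simp
  qed
  moreover have "s / q \<le> 1" using s q by (simp add: field_simps)
  ultimately have ex: "s * q \<le> 1 + 2 * real m * (real ((2*m) choose m) / 4^m)" by linarith
  have "sqrt (2 / (pi * exp 1)) * real n powr (real n / 2)
      = (exp (- 1 / 2) * (real (2*m) + 1) powr (real (2*m) / 2)) * (s * q)"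
    unfolding nt powr_half_eq exp_minus_half s_def q_def by (simp add: real_sqrt_divide real_sqrt_mult mult_ac)
  also have "\<dots> \<le> real (2*m) powr (real (2*m) / 2) * (s * q)"
    using \<open>m > 0\<close> s q by (intro mult_right_mono powr_half_Suc_le) auto
  also have "\<dots> = real (2*m) powr real m * (s * q)" by simp
  also have "\<dots> \<le> real (2*m) powr real m * (1 + 2 * real m * (real ((2*m) choose m) / 4^m))"
    using ex by (intro mult_left_mono) auto
  also have "\<dots> \<le> max_det n" using border by (simp add: nt)
  finally show ?thesis .
qed

lemma max_det_ge_2_mod_4:
  assumes "hadamard_conjecture" and n: "n mod 4 = 2"
  shows "max_det n \<ge> sqrt (8 / (pi * (exp 1)\<^sup>2 * real n)) * real n powr (real n / 2)"
proof -
  define k where "k = n - 1"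
  have nk: "n = Suc k" using n by (cases n) (auto simp: k_def)
  have k: "k mod 4 = 1" using n by (simp add: nk mod_Suc split: if_splits)
  then have "k > 0" by (cases k) auto
  \<comment> \<open>Under the root, 2 * 2 is the doubling by \<open>max_det_Suc\<close>, 2/(pi e)
    the bound for order \<open>k\<close>, and 1/e with 1/n the passage from k^(k/2) to
    n^(n/2).\<close>
  have "8 / (pi * (exp 1)\<^sup>2 * real n) = 2 * 2 * (2 / (pi * exp 1)) / exp 1 / (real k + 1)"
    by (simp add: nk power2_eq_square add.commute)
  then have "sqrt (8 / (pi * (exp 1)\<^sup>2 * real n))
      = 2 * sqrt (2 / (pi * exp 1)) * exp (- 1 / 2) / sqrt (real k + 1)"
    unfolding exp_minus_half by (simp only: real_sqrt_divide real_sqrt_mult) simp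
  then have "sqrt (8 / (pi * (exp 1)\<^sup>2 * real n)) * real n powr (real n / 2)
      = 2 * (sqrt (2 / (pi * exp 1)) * (exp (- 1 / 2) * (real k + 1) powr (real k / 2)))"
    unfolding nk powr_half_eq by simp
  also have "\<dots> \<le> 2 * (sqrt (2 / (pi * exp 1)) * real k powr (real k / 2))"
    using \<open>k > 0\<close> by (intro mult_left_mono powr_half_Suc_le) auto
  also have "\<dots> \<le> 2 * max_det k" using max_det_ge_1_mod_4[OF assms(1) k] by simp
  also have "\<dots> \<le> max_det n" unfolding nk by (rule max_det_Suc[OF \<open>k > 0\<close>])
  finally show ?thesis .
qed

lemma max_det_ge_3_mod_4:
  assumes "hadamard_conjecture" and n: "n mod 4 = 3"
  shows "max_det n \<ge> (real n + 1) powr ((real n - 1) / 2)"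
proof -
  have "Suc n = 4 * (Suc n div 4)" and "Suc n div 4 > 0" and "n > 0" using n by presburger+
  then obtain M where "hadamard_matrix (Suc n) M"
    using assms(1) unfolding hadamard_conjecture_def by metis
  then show ?thesis using max_det_hadamard_minor \<open>n > 0\<close> by blast
qed

text \<open>For positive \<open>n\<close> the left side is (1 + 1/n)^((n-1)/2) / sqrt n, whose first
  factor tends to sqrt e.\<close>

lemma ratio_asymp_equiv:
  "asymp_equiv
             (\<lambda>n::nat. (real n + 1) powr ((real n - 1) / 2) / real n powr (real n / 2)) at_top
             (\<lambda>n. sqrt (exp 1 / real n))"
proof (rule asymp_equivI')
  \<comment> \<open>The quotient of both sides as one exponential of logarithms; the two agree for n
    > 0.\<close>
  let ?g = "\<lambda>n::nat. exp ((real n - 1) / 2 * ln (real n + 1) - real n / 2 * ln (real n) - (1 - ln (real n)) / 2)"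
  have "?g \<longlonglongrightarrow> 1" by real_asymp
  moreover have "eventually (\<lambda>n. ?g n = (real n + 1) powr ((real n - 1) / 2) / real n powr (real n / 2) / sqrt (exp 1 / real n)) at_top"
    using eventually_gt_at_top[of 0]
  proof eventually_elim
    case (elim n)
    have "sqrt (exp 1 / real n) = exp ((1 - ln (real n)) / 2)"
      using elim by (intro real_sqrt_unique) (simp_all add: power2_eq_square exp_diff flip: exp_add)
    then show ?case using elim by (simp add: powr_def exp_diff)
  qed
  ultimately show "(\<lambda>n. (real n + 1) powr ((real n - 1) / 2) / real n powr (real n / 2) / sqrt (exp 1 / real n)) \<longlonglongrightarrow> 1"
    by (rule Lim_transform_eventually)
qed

theorem theorem2:
  assumes "hadamard_conjecture"
  shows "(\<forall>n::nat. n > 0 \<longrightarrow>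
            (n mod 4 = 1 \<longrightarrow> det_ratio n \<ge> sqrt (2 / (pi * exp 1))) \<and>
            (n mod 4 = 2 \<longrightarrow> det_ratio n \<ge> sqrt (8 / (pi * (exp 1)\<^sup>2 * real n))) \<and>
            (n mod 4 = 3 \<longrightarrow>
               det_ratio n \<ge> (real n + 1) powr ((real n - 1) / 2) / real n powr (real n / 2)))
         \<and> asymp_equiv
             (\<lambda>n::nat. (real n + 1) powr ((real n - 1) / 2) / real n powr (real n / 2)) at_top
             (\<lambda>n. sqrt (exp 1 / real n))"
proof (intro conjI allI impI ratio_asymp_equiv)
  fix n :: nat assume "n > 0"
  then have pos: "real n powr (real n / 2) > 0" by simp
  show "det_ratio n \<ge> sqrt (2 / (pi * exp 1))" if "n mod 4 = 1"
    unfolding det_ratio_def pos_le_divide_eq[OF pos] using max_det_ge_1_mod_4[OF assms that] .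
  show "det_ratio n \<ge> sqrt (8 / (pi * (exp 1)\<^sup>2 * real n))" if "n mod 4 = 2"
    unfolding det_ratio_def pos_le_divide_eq[OF pos] using max_det_ge_2_mod_4[OF assms that] .
  show "det_ratio n \<ge> (real n + 1) powr ((real n - 1) / 2) / real n powr (real n / 2)" if "n mod 4 = 3"
    unfolding det_ratio_def using max_det_ge_3_mod_4[OF assms that] pos by (intro divide_right_mono) auto
qed

end
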